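(* Let $G$ be a second-countable locally compact non-compact group, $S\subset G$, $1\le p<+\infty$, let $\Gamma\subset\mathbb{C}$ be such that $\Gamma\setminus\{0\}$ is non-empty, and let $\omega$ be a locally $p$-integrable $S$-admissible weight on $G$. Let $|\Gamma|:=\{|\lambda|:\ \lambda\in\Gamma\}$. Then $L^p(G,\omega)$ has a $(\Gamma,S)$-dense vector if and only if it has a $(|\Gamma|,S)$-dense vector. In particular, $L^p(G,\omega)$ has an $(\mathbb{R}_+,S)$-dense vector if and only if it has a $(\mathbb{C},S)$-dense vector, where $\mathbb{R}_+=[0,+\infty)$.
   Context: Let $\mu$ be a left Haar measure on $G$. A weight on $G$ is a positive measurable function $\omega:G\to(0,+\infty)$; it is locally $p$-integrable if $\int_K\omega^p\,d\mu<+\infty$ for every compact $K\subset G$. $L^p(G,\omega)$ is the space of measurable $f:G\to\mathbb{C}$ (modulo a.e. equality) with $\|f\|_{p,\omega}:=\left(\int_G|f(t)|^p\omega(t)^p\,d\mu(t)\right)^{1/p}<\infty$, with this norm. For $s\in G$, the left translation is $(T_sf)(t)=f(s^{-1}t)$. The weight $\omega$ is $S$-admissible if $M(s):=\operatorname{ess\,sup}_{t\in G}\omega(st)/\omega(t)<+\infty$ for all $s\in S$ (equivalently, $T_s$ is a bounded operator of $L^p(G,\omega)$ into itself for every $s\in S$). For $\Lambda\subset\mathbb{C}$, a vector $f\in L^p(G,\omega)$ is $(\Lambda,S)$-dense if $\{\lambda T_sf:\ \lambda\in\Lambda,\ s\in S\}$ is dense in $L^p(G,\omega)$. *)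

theory Defs
  imports "HOL-Analysis.Analysis" "HOL-Probability.Essential_Supremum"
begin

text \<open>
  Groups are types of class \<open>topological_group_add\<close>. Despite the additive notation this class
  does not assume commutativity: \<open>s + t\<close> stands for the product \<open>st\<close>
  and \<open>- s + t\<close> for \<open>s\<^sup>-\<^sup>1t\<close>. Measurability is with respect to the Borel sets.
\<close>

text \<open>A nonzero left-invariant Radon measure on the Borel sets.\<close>

definition left_haar_measure :: "'g::{topological_group_add, t2_space} measure \<Rightarrow> bool" where
  "left_haar_measure \<mu> \<longleftrightarrow>
     sets \<mu> = sets borel \<and>
     emeasure \<mu> UNIV \<noteq> 0 \<and>
     (\<forall>K. compact K \<longrightarrow> emeasure \<mu> K < \<infinity>) \<and>
     (\<forall>s. \<forall>A\<in>sets borel. emeasure \<mu> ((+) s ` A) = emeasure \<mu> A) \<and>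
     (\<forall>A\<in>sets borel. emeasure \<mu> A = (INF U\<in>{U. open U \<and> A \<subseteq> U}. emeasure \<mu> U)) \<and>
     (\<forall>U. open U \<longrightarrow> emeasure \<mu> U = (SUP K\<in>{K. compact K \<and> K \<subseteq> U}. emeasure \<mu> K))"

definition weight :: "'g measure \<Rightarrow> ('g \<Rightarrow> real) \<Rightarrow> bool" where
  "weight \<mu> \<omega> \<longleftrightarrow> \<omega> \<in> borel_measurable \<mu> \<and> (\<forall>t. 0 < \<omega> t)"

definition locally_p_integrable ::
  "'g::topological_space measure \<Rightarrow> real \<Rightarrow> ('g \<Rightarrow> real) \<Rightarrow> bool" where
  "locally_p_integrable \<mu> p \<omega> \<longleftrightarrow>
     (\<forall>K. compact K \<longrightarrow> (\<integral>\<^sup>+t\<in>K. ennreal (\<omega> t powr p) \<partial>\<mu>) < \<infinity>)"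

definition admissible :: "'g::plus measure \<Rightarrow> 'g set \<Rightarrow> ('g \<Rightarrow> real) \<Rightarrow> bool" where
  "admissible \<mu> S \<omega> \<longleftrightarrow> (\<forall>s\<in>S. esssup \<mu> (\<lambda>t. ereal (\<omega> (s + t) / \<omega> t)) < \<infinity>)"

text \<open>
  Elements of \<open>L\<^sup>p(G, \<omega>)\<close> are represented by functions; two functions denote the same element
  iff they agree almost everywhere, that is, iff \<open>Lp_norm\<close> of their difference vanishes.
  Density with respect to this seminorm is density in the quotient.
\<close>

definition Lp_space :: "'g measure \<Rightarrow> real \<Rightarrow> ('g \<Rightarrow> real) \<Rightarrow> ('g \<Rightarrow> complex) set" where
  "Lp_space \<mu> p \<omega> =
     {f \<in> borel_measurable \<mu>. integrable \<mu> (\<lambda>t. cmod (f t) powr p * \<omega> t powr p)}"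

definition Lp_norm :: "'g measure \<Rightarrow> real \<Rightarrow> ('g \<Rightarrow> real) \<Rightarrow> ('g \<Rightarrow> complex) \<Rightarrow> real" where
  "Lp_norm \<mu> p \<omega> f = (\<integral>t. cmod (f t) powr p * \<omega> t powr p \<partial>\<mu>) powr (1 / p)"

definition dense_in_Lp ::
  "'g measure \<Rightarrow> real \<Rightarrow> ('g \<Rightarrow> real) \<Rightarrow> ('g \<Rightarrow> complex) set \<Rightarrow> bool" where
  "dense_in_Lp \<mu> p \<omega> A \<longleftrightarrow>
     A \<subseteq> Lp_space \<mu> p \<omega> \<and>
     (\<forall>g\<in>Lp_space \<mu> p \<omega>. \<forall>\<epsilon>>0. \<exists>h\<in>A. Lp_norm \<mu> p \<omega> (\<lambda>t. g t - h t) < \<epsilon>)"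

definition left_translate :: "'g::group_add \<Rightarrow> ('g \<Rightarrow> complex) \<Rightarrow> 'g \<Rightarrow> complex" where
  "left_translate s f = (\<lambda>t. f (- s + t))"

definition dense_vector ::
  "'g::group_add measure \<Rightarrow> real \<Rightarrow> ('g \<Rightarrow> real) \<Rightarrow> complex set \<Rightarrow> 'g set \<Rightarrow> ('g \<Rightarrow> complex) \<Rightarrow> bool" where
  "dense_vector \<mu> p \<omega> \<Lambda> S f \<longleftrightarrow>
     f \<in> Lp_space \<mu> p \<omega> \<and>
     dense_in_Lp \<mu> p \<omega> {(\<lambda>t. c * left_translate s f t) | c s. c \<in> \<Lambda> \<and> s \<in> S}"

end

(*
  Let f be (Gamma, S)-dense. Choose c_n in Gamma and s_n in S such that c_n T_{s_n} f is close to a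
  constant C_n on a compact set F_n and close to 0 elsewhere, with the sets s_n^-1 F_n pairwise
  disjoint. On most of s_n^-1 F_n we then have |f| >= C_n / (2 |c_n|), so that for functions phi_n
  bounded by C_n and supported in F_n, and for any c'_n with |c'_n| = |c_n|, the function g equal to
  T_{s_n^-1} phi_n / c'_n on most of s_n^-1 F_n satisfies |g| <= 2 |f|. Pointwise,
    |phi_n - c'_n T_{s_n} g| <= 2 |C_n 1_{F_n} - c_n T_{s_n} f|,
  so g is dense for the c'_n if (phi_n) is dense. Only moduli of the c_n matter.

  That the s_n may be taken to leave any compact set, which gives disjointness, is where
  non-compactness enters: see dense_vector_approx_escaping.
*)

theory Submission
  imports Defs
begin

text \<open>Aiming at the constant \<open>C n\<close> rather than at the function to be reached is
  what makes phases harmless. That function may be small or zero on the set in question, whereas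
  closeness to \<open>C n\<close> bounds the modulus of \<open>f\<close> from below there, so
  \<open>f\<close> majorizes a piece of \<open>g\<close> carrying any phase. The factor 2 is the
  price of the threshold \<open>C n / 2\<close>. The obstacle is that density alone does not prevent
  all good approximants from using translations in one compact set \<open>Q\<close>. If
  \<open>s\<close> lies in \<open>Q\<close>, however, \<open>f\<close> is bounded on most of the
  translates of \<open>F\<close> involved, so \<open>c\<close> has a lower bound that does not
  depend on the accuracy. Hence, on most of any further compact set, the nonzero values of
  \<open>c\<close> times the translate of \<open>f\<close> are bounded below. A far smaller positive
  constant on such a set is then out of reach, although adding it to the target costs arbitrarily
  little in norm. Non-compactness supplies room for that set outside \<open>F\<close>.\<close>

section \<open>The p-th power of the weighted norm\<close>

text \<open>The p-th power of the norm, kept in \<open>ennreal\<close>: it makes sense for every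
  function, and comparisons need neither integrability side conditions nor roots.\<close>

definition Lp_mod :: "'g measure \<Rightarrow> real \<Rightarrow> ('g \<Rightarrow> real) \<Rightarrow> ('g \<Rightarrow> complex) \<Rightarrow> ennreal" where
  "Lp_mod \<mu> p \<omega> f = (\<integral>\<^sup>+t. ennreal (cmod (f t) powr p * \<omega> t powr p) \<partial>\<mu>)"

lemma Lp_space_iff_Lp_mod:
  assumes "weight \<mu> \<omega>"
  shows "f \<in> Lp_space \<mu> p \<omega> \<longleftrightarrow> f \<in> borel_measurable \<mu> \<and> Lp_mod \<mu> p \<omega> f < \<infinity>"
proof -
  have [measurable]: "\<omega> \<in> borel_measurable \<mu>"
    using assms by (simp add: weight_def)
  show ?thesis
    by (auto simp: Lp_space_def Lp_mod_def integrable_iff_bounded)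
qed

lemma Lp_norm_less_iff:
  assumes "weight \<mu> \<omega>" "1 \<le> p" "f \<in> Lp_space \<mu> p \<omega>" "0 < \<epsilon>"
  shows "Lp_norm \<mu> p \<omega> f < \<epsilon> \<longleftrightarrow> Lp_mod \<mu> p \<omega> f < ennreal (\<epsilon> powr p)"
proof -
  let ?I = "\<integral>t. cmod (f t) powr p * \<omega> t powr p \<partial>\<mu>"
  have int: "integrable \<mu> (\<lambda>t. cmod (f t) powr p * \<omega> t powr p)"
    using assms(3) by (simp add: Lp_space_def)
  have "0 \<le> ?I" by simp
  have mod: "Lp_mod \<mu> p \<omega> f = ennreal ?I"
    unfolding Lp_mod_def using int by (intro nn_integral_eq_integral) auto
  have "?I powr (1 / p) < \<epsilon> \<longleftrightarrow> (?I powr (1 / p)) powr p < \<epsilon> powr p"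
    using assms by (meson powr_less_mono2 powr_mono2 linorder_not_less less_eq_real_def
        powr_ge_zero zero_less_one order_less_le_trans)
  also have "(?I powr (1 / p)) powr p = ?I"
    using assms \<open>0 \<le> ?I\<close> by (simp add: powr_powr)
  finally show ?thesis
    using \<open>0 \<le> ?I\<close> by (simp add: mod Lp_norm_def ennreal_less_iff)
qed

text \<open>Crude, from \<open>x + y \<le> 2 * max x y\<close>. Only smallness of norms matters
  later, so this replaces the Minkowski inequality.\<close>

lemma powr_add_le:
  fixes x y p :: real
  assumes "0 \<le> x" "0 \<le> y" "0 \<le> p"
  shows "(x + y) powr p \<le> 2 powr p * (x powr p + y powr p)"
proof -
  have "(x + y) powr p \<le> (2 * max x y) powr p"
    using assms by (intro powr_mono2) auto
  also have "\<dots> = 2 powr p * max x y powr p"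
    using assms by (simp add: powr_mult)
  also have "max x y powr p \<le> x powr p + y powr p"
    by (simp add: max_def)
  finally show ?thesis by simp
qed

lemma Lp_mod_add_le:
  assumes "weight \<mu> \<omega>" "0 \<le> p"
    and [measurable]: "f \<in> borel_measurable \<mu>" "g \<in> borel_measurable \<mu>"
  shows "Lp_mod \<mu> p \<omega> (\<lambda>t. f t + g t) \<le> ennreal (2 powr p) * (Lp_mod \<mu> p \<omega> f + Lp_mod \<mu> p \<omega> g)"
proof -
  have [measurable]: "\<omega> \<in> borel_measurable \<mu>"
    using assms by (simp add: weight_def)
  have "cmod (f t + g t) powr p * \<omega> t powr p
      \<le> 2 powr p * (cmod (f t) powr p * \<omega> t powr p + cmod (g t) powr p * \<omega> t powr p)" for t
  proof -
    have "cmod (f t + g t) powr p \<le> (cmod (f t) + cmod (g t)) powr p"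
      using assms by (intro powr_mono2 norm_triangle_ineq) auto
    also have "\<dots> \<le> 2 powr p * (cmod (f t) powr p + cmod (g t) powr p)"
      using assms by (intro powr_add_le) auto
    finally have "cmod (f t + g t) powr p * \<omega> t powr p
        \<le> (2 powr p * (cmod (f t) powr p + cmod (g t) powr p)) * \<omega> t powr p"
      by (intro mult_right_mono) auto
    thus ?thesis by (simp add: algebra_simps)
  qed
  then have "Lp_mod \<mu> p \<omega> (\<lambda>t. f t + g t) \<le> (\<integral>\<^sup>+t. ennreal (2 powr p) *
     (ennreal (cmod (f t) powr p * \<omega> t powr p) + ennreal (cmod (g t) powr p * \<omega> t powr p)) \<partial>\<mu>)"
    unfolding Lp_mod_def
    by (intro nn_integral_mono) (simp add: ennreal_mult'[symmetric] ennreal_plus[symmetric] del: ennreal_plus)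
  also have "\<dots> = ennreal (2 powr p) * (Lp_mod \<mu> p \<omega> f + Lp_mod \<mu> p \<omega> g)"
    unfolding Lp_mod_def by (simp add: nn_integral_cmult nn_integral_add)
  finally show ?thesis .
qed

lemma Lp_mod_mono:
  assumes "0 \<le> p" "0 \<le> c" "\<And>t. cmod (f t) \<le> c * cmod (g t)" "weight \<mu> \<omega>"
    and [measurable]: "g \<in> borel_measurable \<mu>"
  shows "Lp_mod \<mu> p \<omega> f \<le> ennreal (c powr p) * Lp_mod \<mu> p \<omega> g"
proof -
  have [measurable]: "\<omega> \<in> borel_measurable \<mu>"
    using assms by (simp add: weight_def)
  have "cmod (f t) powr p * \<omega> t powr p \<le> c powr p * (cmod (g t) powr p * \<omega> t powr p)" for t
  proof -
    have "cmod (f t) powr p \<le> (c * cmod (g t)) powr p"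
      using assms by (intro powr_mono2) auto
    then have "cmod (f t) powr p * \<omega> t powr p \<le> (c * cmod (g t)) powr p * \<omega> t powr p"
      by (intro mult_right_mono) auto
    then show ?thesis using assms(2) by (simp add: powr_mult mult_ac)
  qed
  then have "Lp_mod \<mu> p \<omega> f \<le> (\<integral>\<^sup>+t. ennreal (c powr p) * ennreal (cmod (g t) powr p * \<omega> t powr p) \<partial>\<mu>)"
    unfolding Lp_mod_def by (intro nn_integral_mono) (simp add: ennreal_mult'[symmetric])
  also have "\<dots> = ennreal (c powr p) * Lp_mod \<mu> p \<omega> g"
    unfolding Lp_mod_def by (simp add: nn_integral_cmult)
  finally show ?thesis .
qed

lemma Lp_space_diff:
  assumes "weight \<mu> \<omega>" "1 \<le> p" "f \<in> Lp_space \<mu> p \<omega>" "g \<in> Lp_space \<mu> p \<omega>"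
  shows "(\<lambda>t. f t - g t) \<in> Lp_space \<mu> p \<omega>"
proof -
  have [measurable]: "f \<in> borel_measurable \<mu>" "g \<in> borel_measurable \<mu>"
    and fin: "Lp_mod \<mu> p \<omega> f < \<infinity>" "Lp_mod \<mu> p \<omega> g < \<infinity>"
    using assms by (auto simp: Lp_space_iff_Lp_mod)
  have eq: "Lp_mod \<mu> p \<omega> (\<lambda>t. - g t) = Lp_mod \<mu> p \<omega> g"
    by (simp add: Lp_mod_def)
  have "Lp_mod \<mu> p \<omega> (\<lambda>t. f t + - g t)
      \<le> ennreal (2 powr p) * (Lp_mod \<mu> p \<omega> f + Lp_mod \<mu> p \<omega> (\<lambda>t. - g t))"
    using assms by (intro Lp_mod_add_le) auto
  also have "\<dots> < \<infinity>"
    using fin unfolding eq by (simp add: ennreal_mult_less_top)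
  finally show ?thesis
    using assms(1) by (simp add: Lp_space_iff_Lp_mod)
qed

text \<open>Density is unchanged when distances are raised to the power \<open>p\<close>; all later
  arguments use this form.\<close>

lemma dense_in_Lp_iff_Lp_mod:
  assumes "weight \<mu> \<omega>" "1 \<le> p"
  shows "dense_in_Lp \<mu> p \<omega> A \<longleftrightarrow> A \<subseteq> Lp_space \<mu> p \<omega> \<and>
    (\<forall>g\<in>Lp_space \<mu> p \<omega>. \<forall>\<delta>>0. \<exists>h\<in>A. Lp_mod \<mu> p \<omega> (\<lambda>t. g t - h t) < ennreal \<delta>)"
proof (cases "A \<subseteq> Lp_space \<mu> p \<omega>")
  case True
  have diff: "(\<lambda>t. g t - h t) \<in> Lp_space \<mu> p \<omega>" if "g \<in> Lp_space \<mu> p \<omega>" "h \<in> A" for g h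
    using that True assms by (intro Lp_space_diff) auto
  have "\<exists>h\<in>A. Lp_mod \<mu> p \<omega> (\<lambda>t. g t - h t) < ennreal \<delta>"
    if dense: "\<forall>g\<in>Lp_space \<mu> p \<omega>. \<forall>\<epsilon>>0. \<exists>h\<in>A. Lp_norm \<mu> p \<omega> (\<lambda>t. g t - h t) < \<epsilon>"
      and g: "g \<in> Lp_space \<mu> p \<omega>" and "0 < \<delta>" for g \<delta>
  proof -
    have pos: "0 < \<delta> powr (1/p)" using \<open>0 < \<delta>\<close> by simp
    then obtain h where "h \<in> A" "Lp_norm \<mu> p \<omega> (\<lambda>t. g t - h t) < \<delta> powr (1/p)"
      using dense g by blast
    moreover have "(\<delta> powr (1/p)) powr p = \<delta>"
      using assms \<open>0 < \<delta>\<close> by (simp add: powr_powr)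
    ultimately show ?thesis
      using Lp_norm_less_iff[OF assms diff pos] g by auto
  qed
  moreover have "\<exists>h\<in>A. Lp_norm \<mu> p \<omega> (\<lambda>t. g t - h t) < \<epsilon>"
    if dense: "\<forall>g\<in>Lp_space \<mu> p \<omega>. \<forall>\<delta>>0. \<exists>h\<in>A. Lp_mod \<mu> p \<omega> (\<lambda>t. g t - h t) < ennreal \<delta>"
      and g: "g \<in> Lp_space \<mu> p \<omega>" and "0 < \<epsilon>" for g \<epsilon>
  proof -
    have "0 < \<epsilon> powr p" using \<open>0 < \<epsilon>\<close> by simp
    then obtain h where "h \<in> A" "Lp_mod \<mu> p \<omega> (\<lambda>t. g t - h t) < ennreal (\<epsilon> powr p)"
      using dense g by blast
    then show ?thesis
      using Lp_norm_less_iff[OF assms diff] g \<open>0 < \<epsilon>\<close> by blast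
  qed
  ultimately show ?thesis
    unfolding dense_in_Lp_def using True by blast
qed (simp add: dense_in_Lp_def)

lemma emeasure_decseq_less:
  assumes "range E \<subseteq> sets M" "decseq E" "(\<Inter>n. E n) = {}" "emeasure M (E 0) < \<infinity>" "0 < (e::ennreal)"
  shows "\<exists>n. emeasure M (E n) < e"
proof -
  have "emeasure M (E n) \<noteq> \<infinity>" for n
    using emeasure_mono[of "E n" "E 0" M] decseqD[OF \<open>decseq E\<close>, of 0 n] assms(1,4)
    by (auto simp: top_unique)
  then have "(\<lambda>n. emeasure M (E n)) \<longlonglongrightarrow> emeasure M (\<Inter>n. E n)"
    using assms by (intro Lim_emeasure_decseq) auto
  then have "eventually (\<lambda>n. emeasure M (E n) < e) sequentially"
    using assms by (intro order_tendstoD(2)[of _ 0]) auto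
  then show ?thesis
    using eventually_happens'[OF sequentially_bot] by blast
qed

section \<open>Haar measure, compact sets and points missed by small sets\<close>

locale haar_weight =
  fixes \<mu> :: "'g::{topological_group_add, t2_space, second_countable_topology} measure"
    and p :: real and \<omega> :: "'g \<Rightarrow> real"
  assumes haar: "left_haar_measure \<mu>" and p_ge_1: "1 \<le> p" and weight: "weight \<mu> \<omega>"
    and locally_p_integrable: "locally_p_integrable \<mu> p \<omega>"
begin

lemma sets_haar [measurable_cong, simp]: "sets \<mu> = sets borel"
  using haar by (simp add: left_haar_measure_def)

lemma space_haar [simp]: "space \<mu> = UNIV"
  using sets_eq_imp_space_eq[OF sets_haar] by simp

lemma emeasure_compact_less_top: "compact K \<Longrightarrow> emeasure \<mu> K < \<infinity>"
  using haar by (simp add: left_haar_measure_def)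

lemma emeasure_translate: "A \<in> sets borel \<Longrightarrow> emeasure \<mu> ((+) s ` A) = emeasure \<mu> A"
  using haar by (simp add: left_haar_measure_def)

lemma measurable_weight [measurable]: "\<omega> \<in> borel_measurable \<mu>"
  using weight by (simp add: weight_def)

lemma weight_pos: "0 < \<omega> t"
  using weight by (simp add: weight_def)

lemma measurable_plus_left [measurable]: "(+) (s :: 'g) \<in> borel_measurable borel"
  by (intro borel_measurable_continuous_onI continuous_intros)

lemma measurable_left_translate [measurable (raw)]:
  assumes "f \<in> borel_measurable \<mu>"
  shows "left_translate s f \<in> borel_measurable \<mu>"
proof -
  have [measurable]: "f \<in> borel_measurable borel"
    using assms measurable_cong_sets[OF sets_haar refl] by blast
  show ?thesis
    unfolding left_translate_def by measurable
qed

lemma ex_compact_emeasure_pos: "\<exists>K. compact K \<and> 0 < emeasure \<mu> K"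
proof (rule ccontr)
  assume "\<not> ?thesis"
  then have null: "emeasure \<mu> K = 0" if "compact K" for K
    using that by (metis not_gr_zero)
  have "emeasure \<mu> UNIV = (SUP K\<in>{K. compact K \<and> K \<subseteq> UNIV}. emeasure \<mu> K)"
    using haar unfolding left_haar_measure_def by blast
  also have "\<dots> \<le> 0"
    by (intro SUP_least) (auto simp: null)
  finally show False
    using haar by (simp add: left_haar_measure_def)
qed

lemma compact_minus_plus:
  fixes A B :: "'g set"
  assumes "compact A" "compact B"
  shows "compact ((\<lambda>(s, t). - s + t) ` (A \<times> B))"
  unfolding case_prod_unfold
  using assms by (intro compact_continuous_image compact_Times continuous_intros)

lemma compact_plus_minus:
  fixes A B :: "'g set"
  assumes "compact A" "compact B"
  shows "compact ((\<lambda>(s, t). s + - t) ` (A \<times> B))"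
  unfolding case_prod_unfold
  using assms by (intro compact_continuous_image compact_Times continuous_intros)

lemma compact_translate:
  fixes A :: "'g set"
  shows "compact A \<Longrightarrow> compact ((+) s ` A)"
  by (intro compact_continuous_image continuous_intros)

lemma compact_in_borel [measurable]: "compact (K :: 'g set) \<Longrightarrow> K \<in> sets borel"
  by (intro borel_closed compact_imp_closed)

text \<open>A translate \<open>t + K\<close> meets \<open>F\<close> only if \<open>t\<close> lies in
  the set of all \<open>x + - y\<close> with \<open>x\<close> in \<open>F\<close> and
  \<open>y\<close> in \<open>K\<close>. That set is compact, hence not the whole group.\<close>

lemma ex_disjoint_compact:
  assumes "\<not> compact (UNIV :: 'g set)" "compact F"
  shows "\<exists>A. compact A \<and> 0 < emeasure \<mu> A \<and> A \<inter> F = {}"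
proof -
  obtain K where K: "compact K" "0 < emeasure \<mu> K"
    using ex_compact_emeasure_pos by blast
  obtain t where t: "t \<notin> (\<lambda>(s, t). s + - t) ` (F \<times> K)"
    using compact_plus_minus[OF assms(2) K(1)] assms(1) by (metis UNIV_eq_I)
  have "((+) t ` K) \<inter> F = {}"
  proof (rule ccontr)
    assume "((+) t ` K) \<inter> F \<noteq> {}"
    then obtain k where "k \<in> K" "t + k \<in> F" by auto
    then have "(t + k) + - k \<in> (\<lambda>(s, t). s + - t) ` (F \<times> K)" by (intro image_eqI[of _ _ "(t + k, k)"]) auto
    then show False using t by (simp add: add.assoc)
  qed
  then show ?thesis
    using K compact_translate emeasure_translate[of K t] by (metis compact_in_borel)
qed

abbreviation "N \<equiv> Lp_mod \<mu> p \<omega>"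

lemma Lp_mod_indicator_less_top:
  assumes "compact F"
  shows "N (indicator F) < \<infinity>"
proof -
  have "N (indicator F) = (\<integral>\<^sup>+t\<in>F. ennreal (\<omega> t powr p) \<partial>\<mu>)"
    unfolding Lp_mod_def by (intro nn_integral_cong) (auto simp: indicator_def)
  then show ?thesis
    using locally_p_integrable assms by (simp add: locally_p_integrable_def)
qed

lemma Lp_mod_scale:
  assumes [measurable]: "h \<in> borel_measurable \<mu>"
  shows "N (\<lambda>t. c * h t) = ennreal (cmod c powr p) * N h"
proof -
  have "N (\<lambda>t. c * h t) = (\<integral>\<^sup>+t. ennreal (cmod c powr p) * ennreal (cmod (h t) powr p * \<omega> t powr p) \<partial>\<mu>)"
    unfolding Lp_mod_def
    by (intro nn_integral_cong) (simp add: norm_mult powr_mult ennreal_mult'[symmetric] mult_ac)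
  then show ?thesis by (simp add: nn_integral_cmult Lp_mod_def)
qed

text \<open>The weight being bounded below on most of \<open>B\<close>, smallness of \<open>N h\<close> forces \<open>h\<close> to be
  small on most of \<open>B\<close>; by left invariance, \<open>E n\<close> misses most of every translate of \<open>B\<close>.\<close>

lemma ex_small_outside:
  assumes B: "compact B" "0 < emeasure \<mu> B" and "compact Q"
    and E: "\<And>n. E n \<in> sets borel" "decseq E" "(\<Inter>n. E n) = {}"
  shows "\<exists>n. \<forall>a>0. \<exists>\<eta>>0. \<forall>h\<in>borel_measurable \<mu>. N h < ennreal \<eta> \<longrightarrow>
    (\<forall>s\<in>Q. \<exists>t\<in>B. cmod (h t) < a \<and> - s + t \<notin> E n)"
proof -
  \<comment> \<open>Three exceptional sets \<open>W k\<close>, \<open>H\<close> and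
    \<open>D\<close>, each of measure below \<open>m\<close>, will be too small to cover
    \<open>B\<close>.\<close>
  define m where "m = measure \<mu> B / 3"
  have mB: "emeasure \<mu> B = ennreal (3 * m)"
    unfolding m_def using emeasure_compact_less_top[OF B(1)] by (simp add: emeasure_eq_ennreal_measure)
  have "0 < m"
    using B(2) unfolding mB by (simp add: ennreal_zero_less_mult_iff)
  note [measurable] = compact_in_borel[OF B(1)] E(1)
  \<comment> \<open>The sets \<open>E n\<close> may have infinite measure, but only their part in
    the compact set \<open>R\<close> is ever seen, and there continuity from above applies.\<close>
  define R where "R = (\<lambda>(s, t). - s + t) ` (Q \<times> B)"
  have "compact R"
    unfolding R_def using assms by (intro compact_minus_plus)
  note [measurable] = compact_in_borel[OF this]
  \<comment> \<open>This \<open>n\<close> depends on neither \<open>a\<close> nor \<open>s\<close>.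
    The first matters when the height of a perturbation is chosen after the index.\<close>
  have "\<exists>n. emeasure \<mu> (E n \<inter> R) < ennreal m"
  proof (rule emeasure_decseq_less)
    show "decseq (\<lambda>n. E n \<inter> R)" using E(2) by (auto simp: decseq_def)
    have "emeasure \<mu> (E 0 \<inter> R) \<le> emeasure \<mu> R" by (intro emeasure_mono) auto
    then show "emeasure \<mu> (E 0 \<inter> R) < \<infinity>"
      using emeasure_compact_less_top[OF \<open>compact R\<close>] by auto
  qed (use E \<open>0 < m\<close> in auto)
  then obtain n where n: "emeasure \<mu> (E n \<inter> R) < ennreal m" by blast
  define W where "W k = {t\<in>B. \<omega> t powr p < 1 / real (Suc k)}" for k
  have W_meas [measurable]: "W k \<in> sets borel" for k
  proof -
    have "W k = {t \<in> space \<mu>. t \<in> B \<and> \<omega> t powr p < 1 / real (Suc k)}" by (auto simp: W_def)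
    also have "\<dots> \<in> sets \<mu>" by measurable
    finally show ?thesis by simp
  qed
  have "\<exists>k. emeasure \<mu> (W k) < ennreal m"
  proof (rule emeasure_decseq_less)
    show "decseq W"
      unfolding W_def decseq_def
      by (auto elim!: order.strict_trans2 intro!: divide_left_mono)
    show "(\<Inter>k. W k) = {}"
    proof (rule ccontr)
      assume "(\<Inter>k. W k) \<noteq> {}"
      then obtain t where "\<And>k. t \<in> W k" by auto
      then have "\<omega> t powr p < 1 / real (Suc k)" for k by (auto simp: W_def)
      moreover have "0 < \<omega> t powr p" using weight_pos[of t] by simp
      ultimately show False
        using nat_approx_posE by (metis not_less_iff_gr_or_eq)
    qed
    have "emeasure \<mu> (W 0) \<le> emeasure \<mu> B" by (intro emeasure_mono) (auto simp: W_def)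
    then show "emeasure \<mu> (W 0) < \<infinity>" unfolding mB by (auto simp: le_less_trans)
  qed (use \<open>0 < m\<close> in auto)
  then obtain k where k: "emeasure \<mu> (W k) < ennreal m" by blast
  have "\<exists>\<eta>>0. \<forall>h\<in>borel_measurable \<mu>. N h < ennreal \<eta> \<longrightarrow>
    (\<forall>s\<in>Q. \<exists>t\<in>B. cmod (h t) < a \<and> - s + t \<notin> E n)" if "0 < a" for a :: real
  proof -
    \<comment> \<open>At a point of \<open>B\<close> outside \<open>W k\<close>, a value of modulus
      at least \<open>a\<close> makes the integrand of \<open>N h\<close> at least \<open>b\<close>.
      Markov's inequality then gives \<open>H\<close> measure below \<open>m\<close> as soon as
      \<open>N h < b * m\<close>.\<close>
    define b where "b = a powr p / real (Suc k)"
    have "0 < b" unfolding b_def using \<open>0 < a\<close> by simp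
    have "\<exists>t\<in>B. cmod (h t) < a \<and> - s + t \<notin> E n"
      if [measurable]: "h \<in> borel_measurable \<mu>" and small: "N h < ennreal (b * m)" and "s \<in> Q" for h s
    proof (rule ccontr)
      assume neg: "\<not> (\<exists>t\<in>B. cmod (h t) < a \<and> - s + t \<notin> E n)"
      define H where "H = {t \<in> space \<mu>. b \<le> cmod (h t) powr p * \<omega> t powr p}"
      have [measurable]: "H \<in> sets borel" unfolding H_def using sets_haar by measurable
      have "ennreal b * emeasure \<mu> H = (\<integral>\<^sup>+t. ennreal b * indicator H t \<partial>\<mu>)"
        by (simp add: nn_integral_cmult)
      also have "\<dots> \<le> N h"
        unfolding Lp_mod_def
        by (intro nn_integral_mono) (auto simp: H_def indicator_def intro: ennreal_leI)
      also have "\<dots> < ennreal b * ennreal m"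
        using small \<open>0 < b\<close> by (simp add: ennreal_mult')
      finally have H: "emeasure \<mu> H < ennreal m"
        using \<open>0 < b\<close> by (metis linorder_not_less mult_left_mono zero_le)
      \<comment> \<open>The points \<open>t\<close> with \<open>- s + t\<close> in
        \<open>E n \<inter> R\<close>; left invariance makes their measure the same for every
        \<open>s\<close>.\<close>
      define D where "D = (+) s ` (E n \<inter> R)"
      have D: "emeasure \<mu> D < ennreal m"
        unfolding D_def using n by (subst emeasure_translate) auto
      have "D = {t \<in> space \<mu>. - s + t \<in> E n \<inter> R}"
        unfolding D_def by (auto simp: image_iff intro!: bexI[of _ "- s + _"] simp flip: add.assoc)
      also have "\<dots> \<in> sets \<mu>" by measurable
      finally have [measurable]: "D \<in> sets borel" by simp
      have "B \<subseteq> W k \<union> H \<union> D"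
      proof
        fix t assume "t \<in> B"
        show "t \<in> W k \<union> H \<union> D"
        proof (cases "- s + t \<in> E n")
          case True
          moreover have "- s + t \<in> R" using \<open>t \<in> B\<close> \<open>s \<in> Q\<close> by (auto simp: R_def)
          ultimately have "s + (- s + t) \<in> D" unfolding D_def by blast
          then show ?thesis by (simp flip: add.assoc)
        next
          case False
          then have "a \<le> cmod (h t)" using neg \<open>t \<in> B\<close> by (auto simp: not_less)
          then have "a powr p \<le> cmod (h t) powr p"
            using \<open>0 < a\<close> p_ge_1 by (intro powr_mono2) auto
          then have "t \<in> H" if "1 / real (Suc k) \<le> \<omega> t powr p"
            using mult_mono[OF _ that, of "a powr p" "cmod (h t) powr p"] by (simp add: H_def b_def)
          then show ?thesis using \<open>t \<in> B\<close> by (force simp: W_def not_less)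
        qed
      qed
      then have "emeasure \<mu> B \<le> emeasure \<mu> (W k \<union> H \<union> D)" by (intro emeasure_mono) auto
      also have "\<dots> \<le> emeasure \<mu> (W k) + emeasure \<mu> H + emeasure \<mu> D"
        by (intro order.trans[OF emeasure_subadditive] add_mono emeasure_subadditive) auto
      also have "\<dots> < ennreal m + ennreal m + ennreal m"
        using k H D by (intro add_strict_mono)
      also have "\<dots> = emeasure \<mu> B"
        unfolding mB using \<open>0 < m\<close> by (simp flip: ennreal_plus)
      finally show False by simp
    qed
    then show ?thesis using \<open>0 < b\<close> \<open>0 < m\<close> by (intro exI[of _ "b * m"]) auto
  qed
  then show ?thesis by blast
qed


section \<open>Approximation by translates outside a given compact set\<close>

lemma dense_vector_approx:
  assumes "dense_vector \<mu> p \<omega> \<Gamma> S f" "g \<in> borel_measurable \<mu>" "N g < \<infinity>" "0 < \<delta>"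
  shows "\<exists>c\<in>\<Gamma>. \<exists>s\<in>S. N (\<lambda>t. g t - c * left_translate s f t) < ennreal \<delta>"
proof -
  have "g \<in> Lp_space \<mu> p \<omega>"
    using assms Lp_space_iff_Lp_mod[OF weight] by blast
  then show ?thesis
    using assms unfolding dense_vector_def dense_in_Lp_iff_Lp_mod[OF weight p_ge_1] by blast
qed

text \<open>The divisor \<open>2 * 2 powr p\<close> pays for the two summands and for the constant
  of \<open>Lp_mod_add_le\<close>.\<close>

lemma Lp_mod_less_enlarge:
  assumes "h \<in> borel_measurable \<mu>" "k \<in> borel_measurable \<mu>"
    and "N h < ennreal (\<delta> / (2 * 2 powr p))" "N k < ennreal (\<delta> / (2 * 2 powr p))"
  shows "N (\<lambda>t. h t + k t) < ennreal \<delta>"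
proof -
  have "0 < \<delta>"
    using assms(3) by (cases "\<delta> > 0") (auto simp: ennreal_neg divide_nonpos_pos)
  have "N (\<lambda>t. h t + k t) \<le> ennreal (2 powr p) * (N h + N k)"
    using assms weight p_ge_1 by (intro Lp_mod_add_le) auto
  also have "\<dots> < ennreal (2 powr p) * (ennreal (\<delta> / (2 * 2 powr p)) + ennreal (\<delta> / (2 * 2 powr p)))"
    using assms by (intro ennreal_mult_strict_left_mono add_strict_mono) auto
  also have "\<dots> = ennreal \<delta>"
    using \<open>0 < \<delta>\<close> by (simp flip: ennreal_plus ennreal_mult')
  finally show ?thesis .
qed

lemma ex_scale_Lp_mod_less:
  assumes [measurable]: "h \<in> borel_measurable \<mu>" and "N h < \<infinity>" "0 < \<delta>"
  shows "\<exists>e>0. \<forall>c. cmod c \<le> e \<longrightarrow> N (\<lambda>t. c * h t) < ennreal \<delta>"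
proof -
  define v where "v = enn2real (N h)"
  have v: "N h = ennreal v" "0 \<le> v"
    using assms(2) by (auto simp: v_def)
  \<comment> \<open>Dividing by \<open>v + 1\<close> instead of \<open>v\<close> covers
    \<open>v = 0\<close> and leaves the final inequality strict.\<close>
  define e where "e = (\<delta> / (v + 1)) powr (1 / p)"
  have "N (\<lambda>t. c * h t) < ennreal \<delta>" if "cmod c \<le> e" for c
  proof -
    have "cmod c powr p \<le> e powr p"
      using that p_ge_1 by (intro powr_mono2) auto
    also have "\<dots> = \<delta> / (v + 1)"
      using p_ge_1 \<open>0 < \<delta>\<close> v by (simp add: e_def powr_powr)
    finally have "cmod c powr p * v \<le> \<delta> / (v + 1) * v"
      using v by (intro mult_right_mono)
    also have "\<dots> < \<delta>"
      using v \<open>0 < \<delta>\<close> by (simp add: field_simps)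
    finally show ?thesis
      using \<open>0 < \<delta>\<close> v by (subst Lp_mod_scale) (auto simp flip: ennreal_mult intro!: ennreal_lessI)
  qed
  moreover have "0 < e" using \<open>0 < \<delta>\<close> v by (simp add: e_def)
  ultimately show ?thesis by blast
qed

text \<open>The bound on \<open>f\<close> over translates of \<open>F\<close> bounds \<open>\<bar>c\<bar>\<close> from below if \<open>s \<in> Q\<close>. The target is
  perturbed by a constant \<open>a\<close> on a set \<open>A\<close> disjoint from \<open>F\<close>, so small that the nonzero values
  of \<open>c f\<close> over translates of \<open>A\<close> by \<open>Q\<close> are mostly larger.\<close>

lemma dense_vector_approx_escaping:
  assumes dense: "dense_vector \<mu> p \<omega> \<Gamma> S f" and "\<not> compact (UNIV :: 'g set)"
    and F: "compact F" "0 < emeasure \<mu> F" and "compact Q" "0 < C" "0 < \<delta>"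
  shows "\<exists>c\<in>\<Gamma>. \<exists>s\<in>S. c \<noteq> 0 \<and> s \<notin> Q \<and>
    N (\<lambda>t. complex_of_real (C * indicator F t) - c * left_translate s f t) < ennreal \<delta>"
proof -
  have f [measurable]: "f \<in> borel_measurable \<mu>"
    using dense by (simp add: dense_vector_def Lp_space_def)
  then have [measurable]: "f \<in> borel_measurable borel"
    using measurable_cong_sets[OF sets_haar refl] by blast
  obtain A where A: "compact A" "0 < emeasure \<mu> A" "A \<inter> F = {}"
    using ex_disjoint_compact[OF assms(2) F(1)] by blast
  note [measurable] = compact_in_borel[OF F(1)] compact_in_borel[OF A(1)]

  define E where "E n = {t. real n < cmod (f t)}" for n
  have "E n \<in> sets borel" for n unfolding E_def by measurable
  moreover have "decseq E"
    unfolding E_def decseq_def by (auto elim: le_less_trans[rotated])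
  moreover have "(\<Inter>n. E n) = {}"
  proof -
    have "\<exists>n. \<not> real n < cmod (f t)" for t
      using real_arch_simple[of "cmod (f t)"] by (auto simp: not_less)
    then show ?thesis by (auto simp: E_def)
  qed
  \<comment> \<open>Adding \<open>0\<close> to \<open>Q\<close> guarantees a point of
    \<open>F\<close> where \<open>h\<close> is below \<open>C / 2\<close> even if \<open>Q\<close>
    is empty; this is what excludes \<open>c = 0\<close>.\<close>
  ultimately obtain M where M: "\<forall>a>0. \<exists>\<eta>>0. \<forall>h\<in>borel_measurable \<mu>. N h < ennreal \<eta> \<longrightarrow>
    (\<forall>s\<in>insert 0 Q. \<exists>t\<in>F. cmod (h t) < a \<and> - s + t \<notin> E M)"
    using ex_small_outside[OF F, of "insert 0 Q" E] \<open>compact Q\<close> by auto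
  have "0 < C / 2" using \<open>0 < C\<close> by simp
  with M obtain \<eta>F where \<eta>F: "0 < \<eta>F" "\<forall>h\<in>borel_measurable \<mu>. N h < ennreal \<eta>F \<longrightarrow>
    (\<forall>s\<in>insert 0 Q. \<exists>t\<in>F. cmod (h t) < C / 2 \<and> - s + t \<notin> E M)" by blast

  \<comment> \<open>Zeros of \<open>f\<close> are left out because the sets must decrease to the
    empty set, while \<open>f\<close> may vanish on a set of positive measure. The estimate on
    \<open>A\<close> rules zeros out separately.\<close>
  define E' where "E' n = {t. 0 < cmod (f t) \<and> cmod (f t) < 1 / real (Suc n)}" for n
  have "E' n \<in> sets borel" for n unfolding E'_def by measurable
  moreover have "decseq E'"
    unfolding E'_def decseq_def
    by (auto elim!: order.strict_trans2 intro!: divide_left_mono)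
  moreover have "(\<Inter>n. E' n) = {}"
  proof -
    have "\<exists>n. t \<notin> E' n" for t
    proof (cases "0 < cmod (f t)")
      case True
      then obtain n where "1 / real (Suc n) < cmod (f t)" by (rule nat_approx_posE)
      then show ?thesis by (auto simp: E'_def intro!: exI[of _ n])
    qed (auto simp: E'_def)
    then show ?thesis by auto
  qed
  ultimately obtain m where m: "\<forall>a>0. \<exists>\<eta>>0. \<forall>h\<in>borel_measurable \<mu>. N h < ennreal \<eta> \<longrightarrow>
    (\<forall>s\<in>Q. \<exists>t\<in>A. cmod (h t) < a \<and> - s + t \<notin> E' m)"
    using ex_small_outside[OF A(1,2), of "Q" E'] \<open>compact Q\<close> by auto

  \<comment> \<open>The lower bound for \<open>cmod c\<close> when \<open>s\<close> is in
    \<open>Q\<close>: some point of \<open>F\<close> has \<open>cmod (f (- s + t)) \<le> M\<close>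
    although \<open>c * f (- s + t)\<close> exceeds \<open>C / 2\<close> in modulus.\<close>
  define b where "b = C / (2 * real (Suc M))"
  have "0 < b" using \<open>0 < C\<close> by (simp add: b_def)
  define \<delta>' where "\<delta>' = \<delta> / (2 * 2 powr p)"
  have "0 < \<delta>'" using \<open>0 < \<delta>\<close> by (simp add: \<delta>'_def)
  \<comment> \<open>The bound on \<open>a\<close> says \<open>2 * a \<le> b / real (Suc m)\<close>,
    which turns \<open>cmod c * cmod (f (- s + u)) < 2 * a\<close> into a value of \<open>f\<close>
    below \<open>1 / real (Suc m)\<close>. The second condition lets the perturbation be removed at
    the end.\<close>
  have "\<exists>a>0. a \<le> b / (2 * real (Suc m)) \<and> N (\<lambda>t. complex_of_real a * indicator A t) < ennreal \<delta>'"
  proof -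
    have "N (indicator A) < \<infinity>" by (rule Lp_mod_indicator_less_top[OF A(1)])
    then obtain e where e: "0 < e" "\<And>c. cmod c \<le> e \<Longrightarrow> N (\<lambda>t. c * indicator A t) < ennreal \<delta>'"
      using ex_scale_Lp_mod_less[of "indicator A"] \<open>0 < \<delta>'\<close> by auto
    define a where "a = min (b / (2 * real (Suc m))) e"
    have "0 < a" "a \<le> b / (2 * real (Suc m))" "cmod (complex_of_real a) \<le> e"
      using \<open>0 < b\<close> e(1) by (auto simp: a_def)
    then show ?thesis using e(2) by blast
  qed
  then obtain a where a: "0 < a" "a \<le> b / (2 * real (Suc m))"
    "N (\<lambda>t. complex_of_real a * indicator A t) < ennreal \<delta>'" by blast
  have "0 < a / 2" using a by simp
  with m obtain \<eta>A where \<eta>A: "0 < \<eta>A" "\<forall>h\<in>borel_measurable \<mu>. N h < ennreal \<eta>A \<longrightarrow>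
    (\<forall>s\<in>Q. \<exists>t\<in>A. cmod (h t) < a / 2 \<and> - s + t \<notin> E' m)" by blast

  define \<psi> where "\<psi> t = complex_of_real (C * indicator F t) + complex_of_real a * indicator A t" for t
  have [measurable]: "\<psi> \<in> borel_measurable \<mu>" unfolding \<psi>_def by measurable
  have "N \<psi> < \<infinity>"
  proof -
    have "N \<psi> \<le> ennreal (2 powr p) * (N (\<lambda>t. complex_of_real C * indicator F t) + N (\<lambda>t. complex_of_real a * indicator A t))"
      unfolding \<psi>_def of_real_mult of_real_indicator using weight p_ge_1 by (intro Lp_mod_add_le) auto
    also have "\<dots> < \<infinity>"
      using Lp_mod_indicator_less_top[OF F(1)] Lp_mod_indicator_less_top[OF A(1)]
      by (simp add: Lp_mod_scale ennreal_mult_less_top)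
    finally show ?thesis .
  qed
  moreover have "0 < min \<delta>' (min \<eta>F \<eta>A)" using \<open>0 < \<delta>'\<close> \<eta>F \<eta>A by simp
  ultimately obtain c s where cs: "c \<in> \<Gamma>" "s \<in> S"
    "N (\<lambda>t. \<psi> t - c * left_translate s f t) < ennreal (min \<delta>' (min \<eta>F \<eta>A))"
    using dense_vector_approx[OF dense \<open>\<psi> \<in> borel_measurable \<mu>\<close>] by blast
  define h where "h = (\<lambda>t. \<psi> t - c * left_translate s f t)"
  have [measurable]: "h \<in> borel_measurable \<mu>" unfolding h_def by measurable
  have Nh: "N h < ennreal \<delta>'" "N h < ennreal \<eta>F" "N h < ennreal \<eta>A"
    using cs(3) unfolding h_def[symmetric] by (auto elim!: less_le_trans intro!: ennreal_leI)
  have hF: "cmod (h t) = cmod (complex_of_real C - c * f (- s + t))" if "t \<in> F" for t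
    using that A(3) by (auto simp: h_def \<psi>_def left_translate_def indicator_def)
  have hA: "cmod (h t) = cmod (complex_of_real a - c * f (- s + t))" if "t \<in> A" for t
    using that A(3) by (auto simp: h_def \<psi>_def left_translate_def indicator_def)
  have "c \<noteq> 0"
  proof
    assume "c = 0"
    moreover obtain t where "t \<in> F" "cmod (h t) < C / 2"
      using \<eta>F(2) Nh(2) by fastforce
    ultimately show False using hF \<open>0 < C\<close> by auto
  qed
  moreover have "s \<notin> Q"
  proof
    assume "s \<in> Q"
    then obtain t where t: "t \<in> F" "cmod (h t) < C / 2" "- s + t \<notin> E M"
      using \<eta>F(2) Nh(2) by fastforce
    have "C - cmod (c * f (- s + t)) \<le> cmod (h t)"
      unfolding hF[OF t(1)] using norm_triangle_ineq2[of "complex_of_real C"] \<open>0 < C\<close> by fastforce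
    then have "C / 2 < cmod c * cmod (f (- s + t))"
      using t(2) by (simp add: norm_mult)
    also have "\<dots> \<le> cmod c * real (Suc M)"
      using t(3) by (intro mult_left_mono) (auto simp: E_def)
    finally have b: "b < cmod c"
      by (simp add: b_def field_simps)
    obtain u where u: "u \<in> A" "cmod (h u) < a / 2" "- s + u \<notin> E' m"
      using \<eta>A(2) Nh(3) \<open>s \<in> Q\<close> by fastforce
    have "a - cmod (c * f (- s + u)) \<le> cmod (h u)" "cmod (c * f (- s + u)) - a \<le> cmod (h u)"
      unfolding hA[OF u(1)]
      using norm_triangle_ineq2[of "complex_of_real a" "c * f (- s + u)"]
        norm_triangle_ineq2[of "c * f (- s + u)" "complex_of_real a"] \<open>0 < a\<close>
      by (auto simp: norm_minus_commute)
    \<comment> \<open>The lower bound makes \<open>f (- s + u)\<close> nonzero and the upper bound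
      makes it too small, so \<open>- s + u\<close> would lie in \<open>E' m\<close>.\<close>
    then have *: "a / 2 < cmod c * cmod (f (- s + u))" "cmod c * cmod (f (- s + u)) < 2 * a"
      using u(2) by (auto simp: norm_mult)
    have pos: "0 < cmod (f (- s + u))"
      using *(1) \<open>0 < a\<close> by (auto simp: zero_less_mult_iff)
    then have "b * cmod (f (- s + u)) < 2 * a"
      using *(2) b by (meson less_trans mult_strict_right_mono)
    also have "\<dots> \<le> b * (1 / real (Suc m))"
      using a(2) by (simp add: field_simps)
    finally have "cmod (f (- s + u)) < 1 / real (Suc m)"
      using \<open>0 < b\<close> mult_less_cancel_left_pos by blast
    then show False using u(3) pos by (simp add: E'_def)
  qed
  moreover have "N (\<lambda>t. complex_of_real (C * indicator F t) - c * left_translate s f t) < ennreal \<delta>"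
  proof -
    have "N (\<lambda>t. - (complex_of_real a * indicator A t)) = N (\<lambda>t. complex_of_real a * indicator A t)"
      by (simp add: Lp_mod_def)
    then have "N (\<lambda>t. h t + - (complex_of_real a * indicator A t)) < ennreal \<delta>"
      using Nh(1) a(3) unfolding \<delta>'_def by (intro Lp_mod_less_enlarge) auto
    then show ?thesis by (simp add: h_def \<psi>_def)
  qed
  ultimately show ?thesis using cs by blast
qed

end

section \<open>A countable dense family of bounded functions with compact support\<close>

text \<open>By local compactness the open sets contained in compact ones cover the space; Lindelof
  extracts a countable subcover, and finite unions of the compact hulls increase to
  everything.\<close>

lemma ex_compact_exhaustion:
  assumes "locally_compact_space (euclidean :: 'a::second_countable_topology topology)"
  shows "\<exists>F :: nat \<Rightarrow> 'a set. (\<forall>n. compact (F n)) \<and> incseq F \<and> (\<Union>n. F n) = UNIV"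
proof -
  define \<F> where "\<F> = {U :: 'a set. open U \<and> (\<exists>K. compact K \<and> U \<subseteq> K)}"
  have "\<Union>\<F> = UNIV"
    using assms by (fastforce simp: locally_compact_space_def \<F>_def)
  obtain \<G> where \<G>: "\<G> \<subseteq> \<F>" "countable \<G>" "\<Union>\<G> = \<Union>\<F>"
    using Lindelof[of \<F>] by (auto simp: \<F>_def)
  have "\<G> \<noteq> {}" using \<G>(3) \<open>\<Union>\<F> = UNIV\<close> by auto
  have "\<forall>U\<in>\<G>. \<exists>K. compact K \<and> U \<subseteq> K" using \<G>(1) by (auto simp: \<F>_def)
  then obtain K where K: "\<And>U. U \<in> \<G> \<Longrightarrow> compact (K U) \<and> U \<subseteq> K U" by metis
  define F where "F n = (\<Union>i\<le>n. K (from_nat_into \<G> i))" for n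
  have "compact (F n)" for n
    unfolding F_def using K from_nat_into[OF \<open>\<G> \<noteq> {}\<close>] by (intro compact_UN) auto
  moreover have "incseq F"
    unfolding F_def incseq_def by (auto intro: order_trans)
  moreover have "(\<Union>n. F n) = UNIV"
  proof -
    have "\<exists>n. x \<in> F n" for x
    proof -
      have "x \<in> \<Union>\<G>" using \<G>(3) \<open>\<Union>\<F> = UNIV\<close> by simp
      then obtain U where "U \<in> \<G>" "x \<in> U" by blast
      moreover obtain n where "from_nat_into \<G> n = U"
        using from_nat_into_surj[OF \<G>(2) \<open>U \<in> \<G>\<close>] by blast
      ultimately have "x \<in> K (from_nat_into \<G> n)" using K by blast
      then show ?thesis unfolding F_def by blast
    qed
    then show ?thesis by auto
  qed
  ultimately show ?thesis by blast
qed

text \<open>A countable family closed under intersection. Indexing by lists turns intersection into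
  concatenation, and the empty list supplies the whole space, from which complements are taken
  later.\<close>

lemma ex_countable_Int_generator:
  "\<exists>B :: nat list \<Rightarrow> 'a::second_countable_topology set.
     B [] = UNIV \<and> (\<forall>k l. B (k @ l) = B k \<inter> B l) \<and> sets borel = sigma_sets UNIV (range B)"
proof -
  obtain \<B> :: "'a set set" where \<B>: "countable \<B>" "topological_basis \<B>"
    using ex_countable_basis by blast
  define b where "b = from_nat_into (insert UNIV \<B>)"
  have range_b: "range b = insert UNIV \<B>"
    unfolding b_def using \<B>(1) by (intro range_from_nat_into) auto
  define B where "B l = (\<Inter>i\<in>set l. b i)" for l
  have "open (b i)" for i
    using range_b topological_basis_open[OF \<B>(2)] by (metis insert_iff open_UNIV rangeI)
  then have "open (B l)" for l unfolding B_def by auto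
  then have "sigma_sets UNIV (range B) \<subseteq> sets borel"
    by (auto intro!: sets.sigma_sets_subset[of _ borel, simplified])
  moreover have "sets borel \<subseteq> sigma_sets UNIV (range B)"
  proof -
    have "sets (borel :: 'a measure) = sigma_sets UNIV \<B>"
      by (simp add: borel_eq_countable_basis[OF \<B>])
    moreover have "\<B> \<subseteq> range B"
    proof
      fix U assume "U \<in> \<B>"
      then obtain i where "U = b i" using range_b by (metis imageE insertI2)
      then have "U = B [i]" by (simp add: B_def)
      then show "U \<in> range B" by blast
    qed
    ultimately show ?thesis by (simp add: sigma_sets_mono')
  qed
  moreover have "B [] = UNIV" "\<forall>k l. B (k @ l) = B k \<inter> B l" by (auto simp: B_def)
  ultimately show ?thesis by (intro exI[of _ B]) auto
qed

context haar_weight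
begin

lemma Lp_mod_dominated_convergence:
  assumes [measurable]: "\<And>i. h i \<in> borel_measurable \<mu>" "g \<in> borel_measurable \<mu>"
    and "N g < \<infinity>" and bound: "\<And>i t. cmod (h i t) \<le> cmod (g t)" and lim: "\<And>t. (\<lambda>i. h i t) \<longlonglongrightarrow> 0"
  shows "(\<lambda>i. N (h i)) \<longlonglongrightarrow> 0"
proof -
  have "(\<lambda>i. N (h i)) \<longlonglongrightarrow> (\<integral>\<^sup>+t. 0 \<partial>\<mu>)"
    unfolding Lp_mod_def
  proof (rule nn_integral_dominated_convergence[where w = "\<lambda>t. ennreal (cmod (g t) powr p * \<omega> t powr p)"])
    show "AE t in \<mu>. ennreal (cmod (h i t) powr p * \<omega> t powr p) \<le> ennreal (cmod (g t) powr p * \<omega> t powr p)" for i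
      using bound p_ge_1 by (intro AE_I2 ennreal_leI mult_right_mono powr_mono2) auto
    show "AE t in \<mu>. (\<lambda>i. ennreal (cmod (h i t) powr p * \<omega> t powr p)) \<longlonglongrightarrow> 0"
    proof (rule AE_I2)
      fix t
      have "(\<lambda>i. cmod (h i t)) \<longlonglongrightarrow> 0" using lim tendsto_norm_zero by blast
      then have "(\<lambda>i. cmod (h i t) powr p) \<longlonglongrightarrow> 0"
        using p_ge_1 by (intro tendsto_zero_powrI[of _ _ _ p]) auto
      then have "(\<lambda>i. cmod (h i t) powr p * \<omega> t powr p) \<longlonglongrightarrow> 0" by (rule tendsto_mult_left_zero)
      then show "(\<lambda>i. ennreal (cmod (h i t) powr p * \<omega> t powr p)) \<longlonglongrightarrow> 0"
        using tendsto_ennrealI by fastforce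
    qed
    show "(\<integral>\<^sup>+t. ennreal (cmod (g t) powr p * \<omega> t powr p) \<partial>\<mu>) < \<infinity>"
      using assms(3) by (simp add: Lp_mod_def)
  qed measurable
  then show ?thesis by simp
qed

text \<open>The family consists of finite sums of indicators of generator sets cut down to an
  exhausting compact set, with coefficients from a countable dense set. Such sums are coded by
  lists, hence countable, and an induction over Borel sets shows that they suffice.\<close>

lemma ex_countable_dense_compact_support:
  assumes "locally_compact_space (euclidean :: 'g topology)"
  shows "\<exists>\<phi> :: nat \<Rightarrow> 'g \<Rightarrow> complex. (\<forall>n. \<phi> n \<in> borel_measurable \<mu>) \<and>
    (\<forall>n. \<exists>C F. compact F \<and> (\<forall>t. cmod (\<phi> n t) \<le> C * indicator F t)) \<and>
    (\<forall>g\<in>borel_measurable \<mu>. N g < \<infinity> \<longrightarrow> (\<forall>\<delta>>0. \<exists>n. N (\<lambda>t. g t - \<phi> n t) < ennreal \<delta>))"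
proof -
  obtain F :: "nat \<Rightarrow> 'g set" where F: "\<And>n. compact (F n)" "incseq F" "(\<Union>n. F n) = UNIV"
    using ex_compact_exhaustion[OF assms] by blast
  obtain B :: "nat list \<Rightarrow> 'g set" where B: "B [] = UNIV" "\<And>k l. B (k @ l) = B k \<inter> B l"
    "sets borel = sigma_sets UNIV (range B)"
    using ex_countable_Int_generator by blast
  obtain D :: "complex set" where D: "countable D" "\<And>X. open X \<Longrightarrow> X \<noteq> {} \<Longrightarrow> \<exists>d\<in>D. d \<in> X"
    using countable_dense_setE by blast
  define q where "q = from_nat_into D"
  have "D \<noteq> {}" using D(2)[of UNIV] by auto
  have q: "\<exists>i. cmod (c - q i) < e" if e: "0 < e" for c e
  proof -
    obtain d where "d \<in> D" "d \<in> ball c e" using D(2)[of "ball c e"] e by auto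
    then show ?thesis
      using from_nat_into_surj[OF D(1) \<open>d \<in> D\<close>] by (auto simp: q_def dist_norm)
  qed
  note [measurable] = compact_in_borel[OF F(1)]
  have [measurable]: "B k \<in> sets borel" for k
    unfolding B(3) by (intro sigma_sets.Basic rangeI)
  define step where "step l t = (\<Sum>(i, k, n)\<leftarrow>l. q i * indicator (B k \<inter> F n) t)" for l t
  have step_simps: "step [] = (\<lambda>t. 0 :: complex)"
    "\<And>i k n l. step ((i, k, n) # l) = (\<lambda>t. q i * indicator (B k \<inter> F n) t + step l t)"
    "\<And>k l. step (k @ l) = (\<lambda>t. step k t + step l t)"
    by (auto simp: step_def fun_eq_iff)
  have [measurable]: "step l \<in> borel_measurable \<mu>" for l
    by (induction l) (auto simp: step_simps)
  have step_bound: "\<exists>C F. compact F \<and> (\<forall>t. cmod (step l t) \<le> C * indicator F t)" for l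
  proof (induction l)
    case Nil
    show ?case by (intro exI[of _ 0] exI[of _ "{}"]) (auto simp: step_simps)
  next
    case (Cons x l)
    obtain i k n where x: "x = (i, k, n)" by (cases x)
    obtain C K where K: "compact K" "\<And>t. cmod (step l t) \<le> C * indicator K t" using Cons by blast
    have "cmod (step (x # l) t) \<le> (cmod (q i) + \<bar>C\<bar>) * indicator (F n \<union> K) t" for t
    proof -
      have "cmod (step (x # l) t) \<le> cmod (q i * indicator (B k \<inter> F n) t) + cmod (step l t)"
        unfolding x step_simps by (rule norm_triangle_ineq)
      also have "\<dots> \<le> cmod (q i) * indicator (F n \<union> K) t + \<bar>C\<bar> * indicator (F n \<union> K) t"
        by (intro add_mono order_trans[OF K(2)]) (auto simp: indicator_def norm_mult)
      finally show ?thesis by (simp add: algebra_simps)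
    qed
    moreover have "compact (F n \<union> K)" using F(1) K(1) by auto
    ultimately show ?case
      by (intro exI[of _ "cmod (q i) + \<bar>C\<bar>"] exI[of _ "F n \<union> K"]) auto
  qed
  \<comment> \<open>The functions in the closure of the \<open>step l\<close>. Stability under sums
    and under limits in \<open>N\<close> is what the induction over Borel sets consumes.\<close>
  define ap where "ap h \<longleftrightarrow> h \<in> borel_measurable \<mu> \<and> (\<forall>\<delta>>0. \<exists>l. N (\<lambda>t. h t - step l t) < ennreal \<delta>)" for h
  have ap_meas: "h \<in> borel_measurable \<mu>" if "ap h" for h using that by (simp add: ap_def)
  have ap_add: "ap (\<lambda>t. h t + k t)" if "ap h" "ap k" for h k
    unfolding ap_def
  proof (intro conjI allI impI)
    have [measurable]: "h \<in> borel_measurable \<mu>" "k \<in> borel_measurable \<mu>" using that ap_meas by auto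
    show "(\<lambda>t. h t + k t) \<in> borel_measurable \<mu>" by measurable
    fix \<delta> :: real assume "0 < \<delta>"
    then have "0 < \<delta> / (2 * 2 powr p)" by simp
    with that obtain l l' where "N (\<lambda>t. h t - step l t) < ennreal (\<delta> / (2 * 2 powr p))"
      "N (\<lambda>t. k t - step l' t) < ennreal (\<delta> / (2 * 2 powr p))"
      unfolding ap_def by meson
    then have "N (\<lambda>t. (h t - step l t) + (k t - step l' t)) < ennreal \<delta>"
      by (intro Lp_mod_less_enlarge) auto
    then show "\<exists>l. N (\<lambda>t. h t + k t - step l t) < ennreal \<delta>"
      by (intro exI[of _ "l @ l'"]) (simp add: step_simps algebra_simps)
  qed
  have ap_lim: "ap h" if [measurable]: "h \<in> borel_measurable \<mu>" and ap_k: "\<And>i. ap (k i)"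
    and lim: "(\<lambda>i. N (\<lambda>t. h t - k i t)) \<longlonglongrightarrow> 0" for h and k :: "nat \<Rightarrow> 'g \<Rightarrow> complex"
    unfolding ap_def
  proof (intro conjI allI impI)
    fix \<delta> :: real assume "0 < \<delta>"
    then have pos: "0 < \<delta> / (2 * 2 powr p)" by simp
    then have "\<forall>\<^sub>F i in sequentially. N (\<lambda>t. h t - k i t) < ennreal (\<delta> / (2 * 2 powr p))"
      using lim by (intro order_tendstoD(2)) (auto simp: ennreal_zero_less_divide)
    then obtain i where i: "N (\<lambda>t. h t - k i t) < ennreal (\<delta> / (2 * 2 powr p))"
      using eventually_happens'[OF sequentially_bot] by blast
    have [measurable]: "k i \<in> borel_measurable \<mu>" using ap_meas[OF ap_k] .
    obtain l where "N (\<lambda>t. k i t - step l t) < ennreal (\<delta> / (2 * 2 powr p))"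
      using ap_k[of i] pos unfolding ap_def by meson
    with i have "N (\<lambda>t. (h t - k i t) + (k i t - step l t)) < ennreal \<delta>"
      by (intro Lp_mod_less_enlarge) auto
    then show "\<exists>l. N (\<lambda>t. h t - step l t) < ennreal \<delta>" by auto
  qed measurable
  have ap_0: "ap (\<lambda>t. 0)"
    unfolding ap_def by (auto intro!: exI[of _ "[]"] simp: step_simps Lp_mod_def)
  have ap_basic: "ap (\<lambda>t. c * indicator (B k \<inter> F n) t)" for c k n
  proof -
    have fin: "N (indicator (B k \<inter> F n)) < \<infinity>"
    proof -
      have "N (indicator (B k \<inter> F n)) \<le> ennreal (1 powr p) * N (indicator (F n))"
        using p_ge_1 weight by (intro Lp_mod_mono) (auto simp: indicator_def)
      then show ?thesis using Lp_mod_indicator_less_top[OF F(1)[of n]] by (auto simp: le_less_trans)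
    qed
    show ?thesis
      unfolding ap_def
    proof (intro allI conjI impI)
      fix \<delta> :: real assume "0 < \<delta>"
      then obtain e where e: "0 < e" "\<And>c. cmod c \<le> e \<Longrightarrow> N (\<lambda>t. c * indicator (B k \<inter> F n) t) < ennreal \<delta>"
        using ex_scale_Lp_mod_less[OF _ fin] by auto
      obtain i where "cmod (c - q i) < e" using q[OF e(1)] by blast
      then have "N (\<lambda>t. (c - q i) * indicator (B k \<inter> F n) t) < ennreal \<delta>" by (intro e(2)) auto
      then show "\<exists>l. N (\<lambda>t. c * indicator (B k \<inter> F n) t - step l t) < ennreal \<delta>"
        by (intro exI[of _ "[(i, k, n)]"]) (simp add: step_simps algebra_simps)
    qed measurable
  qed
  \<comment> \<open>The coefficient is quantified inside the induction because the complement case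
    uses the hypothesis for \<open>- c\<close>. Intersecting with \<open>F n\<close> keeps a
    function of finite norm available as a majorant.\<close>
  have ap_indicator: "\<forall>c. ap (\<lambda>t. c * indicator (A \<inter> F n) t)" if "A \<in> sets borel" for A n
  proof -
    have "Int_stable (range B)"
      unfolding Int_stable_def using B(2) by (metis (no_types, lifting) imageE rangeI)
    moreover have "range B \<subseteq> Pow UNIV" by simp
    moreover have "A \<in> sigma_sets UNIV (range B)" using that B(3) by simp
    ultimately show ?thesis
    proof (induction rule: sigma_sets_induct_disjoint)
      case (basic A)
      then obtain k where "A = B k" by blast
      then show ?case using ap_basic by simp
    next
      case empty
      then show ?case using ap_0 by simp
    next
      case (compl A)
      have "ap (\<lambda>t. c * indicator (B [] \<inter> F n) t + - c * indicator (A \<inter> F n) t)" for c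
        by (rule ap_add[OF ap_basic compl.IH[rule_format]])
      moreover have "(\<lambda>t. c * indicator (B [] \<inter> F n) t + - c * indicator (A \<inter> F n) t) =
          (\<lambda>t. c * indicator ((UNIV - A) \<inter> F n) t)" for c :: complex
        by (auto simp: B(1) fun_eq_iff indicator_def)
      ultimately show ?case by simp
    next
      case (union A)
      then have [measurable]: "A i \<in> sets borel" for i using B(3) by blast
      show ?case
      proof (rule allI, rule ap_lim)
        fix c :: complex and m :: nat
        show "ap (\<lambda>t. c * indicator ((\<Union>i<m. A i) \<inter> F n) t)"
        proof (induction m)
          case (Suc m)
          have "ap (\<lambda>t. c * indicator ((\<Union>i<m. A i) \<inter> F n) t + c * indicator (A m \<inter> F n) t)"
            by (rule ap_add[OF Suc union.IH[rule_format]])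
          moreover have "A i \<inter> A m = {}" if "i < m" for i
            using union.hyps(1) that by (auto simp: disjoint_family_on_def)
          then have "(\<lambda>t. c * indicator ((\<Union>i<m. A i) \<inter> F n) t + c * indicator (A m \<inter> F n) t) =
              (\<lambda>t. c * indicator ((\<Union>i<Suc m. A i) \<inter> F n) t)"
            by (auto simp: fun_eq_iff indicator_def less_Suc_eq)
          ultimately show ?case by simp
        qed (simp add: ap_0)
      next
        fix c :: complex
        define h where "h m = (\<lambda>t. c * indicator ((\<Union>i. A i) \<inter> F n) t - c * indicator ((\<Union>i<m. A i) \<inter> F n) t)" for m
        have "(\<lambda>m. N (h m)) \<longlonglongrightarrow> 0"
        proof (rule Lp_mod_dominated_convergence)
          show "h m \<in> borel_measurable \<mu>" for m unfolding h_def by measurable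
          show "N (\<lambda>t. c * indicator (F n) t) < \<infinity>"
            using Lp_mod_indicator_less_top[OF F(1)[of n]]
            by (simp add: Lp_mod_scale ennreal_mult_less_top)
          show "cmod (h m t) \<le> cmod (c * indicator (F n) t)" for m t
            by (auto simp: h_def indicator_def)
          show "(\<lambda>m. h m t) \<longlonglongrightarrow> 0" for t
          proof (cases "t \<in> (\<Union>i. A i)")
            case True
            then obtain i where "t \<in> A i" by blast
            then have "h m t = 0" if "i < m" for m
              using that by (auto simp: h_def indicator_def)
            then show ?thesis
              by (intro tendsto_eventually eventually_sequentiallyI[of "Suc i"]) auto
          qed (auto simp: h_def indicator_def)
        qed measurable
        then show "(\<lambda>m. N (\<lambda>t. c * indicator ((\<Union>i. A i) \<inter> F n) t - c * indicator ((\<Union>i<m. A i) \<inter> F n) t)) \<longlonglongrightarrow> 0"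
          by (simp add: h_def)
      qed measurable
    qed
  qed
  have ap_sum: "ap (\<lambda>t. \<Sum>y\<in>Y. h y t)" if "finite Y" "\<And>y. ap (h y)" for Y :: "complex set" and h
    using that(1)
  proof (induction Y rule: finite_induct)
    case (insert y Y)
    then show ?case using ap_add[OF that(2)[of y] insert.IH] by simp
  qed (simp add: ap_0)
  have ap_all: "ap g" if g [measurable]: "g \<in> borel_measurable \<mu>" and fin: "N g < \<infinity>" for g
  proof -
    obtain s where s: "\<And>i. simple_function \<mu> (s i)" "\<And>t. (\<lambda>i. s i t) \<longlonglongrightarrow> g t"
      "\<And>i t. cmod (s i t) \<le> 2 * cmod (g t)"
      using borel_measurable_implies_sequence_metric[OF g, of 0] by auto
    have [measurable]: "s i \<in> borel_measurable \<mu>" for i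
      using s(1) borel_measurable_simple_function by blast
    \<comment> \<open>The cutoff brings every level set into the scope of
      \<open>ap_indicator\<close>; each point lies in \<open>F i\<close> eventually, so the
      pointwise limit is unaffected.\<close>
    define k where "k i t = s i t * indicator (F i) t" for i t
    show ?thesis
    proof (rule ap_lim[of g k])
      fix i
      have "k i t = (\<Sum>y\<in>range (s i). y * indicator (s i -` {y} \<inter> F i) t)" for t
      proof -
        have "s i t = (\<Sum>y\<in>range (s i). indicator (s i -` {y}) t *\<^sub>R y)"
          using simple_function_indicator_representation_banach[OF s(1)[of i], of t]
          unfolding space_haar Int_UNIV_right by blast
        then have "k i t = (\<Sum>y\<in>range (s i). indicator (s i -` {y}) t *\<^sub>R y * indicator (F i) t)"
          unfolding k_def by (simp only: sum_distrib_right)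
        also have "\<dots> = (\<Sum>y\<in>range (s i). y * indicator (s i -` {y} \<inter> F i) t)"
          by (intro sum.cong refl) (simp add: indicator_def)
        finally show ?thesis .
      qed
      then have k_eq: "k i = (\<lambda>t. \<Sum>y\<in>range (s i). y * indicator (s i -` {y} \<inter> F i) t)" by blast
      have "s i -` {y} \<in> sets borel" for y
        using simple_functionD(2)[OF s(1)[of i], of "{y}"] by simp
      then have "ap (\<lambda>t. y * indicator (s i -` {y} \<inter> F i) t)" for y
        using ap_indicator by blast
      moreover have "finite (range (s i))"
        using simple_functionD(1)[OF s(1)[of i]] by simp
      ultimately show "ap (k i)"
        unfolding k_eq by (intro ap_sum)
    next
      show "(\<lambda>i. N (\<lambda>t. g t - k i t)) \<longlonglongrightarrow> 0"
      proof (rule Lp_mod_dominated_convergence)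
        \<comment> \<open>The factor is 1 + 2: the simple functions are bounded by
          \<open>2 * cmod (g t)\<close>.\<close>
        show "N (\<lambda>t. 3 * g t) < \<infinity>" using fin by (simp add: Lp_mod_scale ennreal_mult_less_top)
        show "cmod (g t - k i t) \<le> cmod (3 * g t)" for i t
        proof -
          have "cmod (g t - k i t) \<le> cmod (g t) + cmod (k i t)" by (rule norm_triangle_ineq4)
          also have "cmod (k i t) \<le> 2 * cmod (g t)"
            using s(3)[of i t] by (auto simp: k_def indicator_def)
          finally show ?thesis by (simp add: norm_mult)
        qed
        show "(\<lambda>i. g t - k i t) \<longlonglongrightarrow> 0" for t
        proof -
          obtain n where "t \<in> F n" using F(3) by blast
          then have "k i t = s i t" if "n \<le> i" for i
            using incseqD[OF F(2) that] by (auto simp: k_def)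
          then have "\<forall>\<^sub>F i in sequentially. s i t = k i t"
            by (intro eventually_sequentiallyI[of n]) auto
          then have "(\<lambda>i. k i t) \<longlonglongrightarrow> g t"
            by (rule Lim_transform_eventually[OF s(2)])
          from tendsto_diff[OF tendsto_const[of "g t"] this] show ?thesis by simp
        qed
      qed (simp_all add: k_def)
    qed measurable
  qed
  define \<phi> :: "nat \<Rightarrow> 'g \<Rightarrow> complex" where "\<phi> n = step (from_nat n)" for n
  have "\<exists>n. N (\<lambda>t. g t - \<phi> n t) < ennreal \<delta>"
    if g: "g \<in> borel_measurable \<mu>" "N g < \<infinity>" and \<delta>: "0 < \<delta>" for g \<delta>
  proof -
    obtain l where "N (\<lambda>t. g t - step l t) < ennreal \<delta>"
      using ap_all[OF g] \<delta> unfolding ap_def by blast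
    then show ?thesis by (intro exI[of _ "to_nat l"]) (simp add: \<phi>_def)
  qed
  moreover have "\<phi> n \<in> borel_measurable \<mu>" for n unfolding \<phi>_def by measurable
  moreover have "\<exists>C F. compact F \<and> (\<forall>t. cmod (\<phi> n t) \<le> C * indicator F t)" for n
    unfolding \<phi>_def by (rule step_bound)
  ultimately show ?thesis by (intro exI[of _ \<phi>]) blast
qed


section \<open>Construction of the new dense vector\<close>

text \<open>The one-sided condition on moduli holds between a set and its set of moduli in both
  orders, so both directions of the equivalence are instances.\<close>

lemma dense_vector_transfer:
  assumes lc: "locally_compact_space (euclidean :: 'g topology)"
    and nc: "\<not> compact (UNIV :: 'g set)"
    and dense: "dense_vector \<mu> p \<omega> \<Gamma> S f"
    and same_mod: "\<And>c. c \<in> \<Gamma> \<Longrightarrow> \<exists>c'\<in>\<Gamma>'. cmod c' = cmod c"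
  shows "\<exists>g. dense_vector \<mu> p \<omega> \<Gamma>' S g"
proof -
  have f [measurable]: "f \<in> borel_measurable \<mu>" and "N f < \<infinity>"
    using dense Lp_space_iff_Lp_mod[OF weight] by (auto simp: dense_vector_def)
  have [measurable]: "f \<in> borel_measurable borel"
    using f measurable_cong_sets[OF sets_haar refl] by blast
  obtain \<phi> :: "nat \<Rightarrow> 'g \<Rightarrow> complex" where \<phi>: "\<And>n. \<phi> n \<in> borel_measurable \<mu>"
    "\<And>n. \<exists>C F. compact F \<and> (\<forall>t. cmod (\<phi> n t) \<le> C * indicator F t)"
    "\<And>g \<delta>. g \<in> borel_measurable \<mu> \<Longrightarrow> N g < \<infinity> \<Longrightarrow> 0 < \<delta> \<Longrightarrow> \<exists>n. N (\<lambda>t. g t - \<phi> n t) < ennreal \<delta>"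
    using ex_countable_dense_compact_support[OF lc] by blast
  obtain C0 F0 where F0: "\<And>n. compact (F0 n)" "\<And>n t. cmod (\<phi> n t) \<le> C0 n * indicator (F0 n) t"
    using \<phi>(2) by metis
  obtain K where K: "compact K" "0 < emeasure \<mu> K"
    using ex_compact_emeasure_pos by blast
  text \<open>Each \<open>\<phi> m\<close> is repeated infinitely often, so that the approximation errors along its
    occurrences tend to \<open>0\<close>.\<close>
  define \<psi> where "\<psi> n = \<phi> (fst (prod_decode n))" for n
  \<comment> \<open>Joining \<open>K\<close> and, below, adding 1 to the bound give the positive
    measure and the positive constant that \<open>dense_vector_approx_escaping\<close>
    requires.\<close>
  define F where "F n = F0 (fst (prod_decode n)) \<union> K" for n
  define C where "C n = \<bar>C0 (fst (prod_decode n))\<bar> + 1" for n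
  have compact_F: "compact (F n)" for n
    unfolding F_def using F0(1) K(1) by (intro compact_Un)
  note [measurable] = compact_in_borel[OF compact_F]
  have F_pos: "0 < emeasure \<mu> (F n)" for n
    using K emeasure_mono[of K "F n" \<mu>] by (auto simp: F_def less_le_trans compact_in_borel F0)
  have C_pos: "0 < C n" for n by (simp add: C_def)
  have \<psi>_bound: "cmod (\<psi> n t) \<le> C n * indicator (F n) t" for n t
    unfolding \<psi>_def by (rule order_trans[OF F0(2)]) (auto simp: C_def F_def indicator_def)
  have "\<psi> n \<in> borel_measurable \<mu>" for n unfolding \<psi>_def by (rule \<phi>(1))
  then have [measurable]: "\<psi> n \<in> borel_measurable borel" for n
    using measurable_cong_sets[OF sets_haar refl] by blast

  \<comment> \<open>The translate of \<open>F n\<close> by \<open>- s n\<close> meets that of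
    \<open>F j\<close> by \<open>- s j\<close> exactly when \<open>s n\<close> is in
    \<open>Q n j (s j)\<close>. Avoiding these compact sets for all \<open>j < n\<close> makes the
    translates disjoint.\<close>
  define Q where "Q n j u = (\<lambda>z. z + u) ` (\<lambda>(x, y). x + - y) ` (F n \<times> F j)" for n j and u :: 'g
  have compact_Q: "compact (Q n j u)" for n j u
    unfolding Q_def
    by (rule compact_continuous_image[OF _ compact_plus_minus[OF compact_F compact_F]])
      (intro continuous_intros)
  define P where "P x n r \<longleftrightarrow> fst r \<in> \<Gamma> \<and> snd r \<in> S \<and> fst r \<noteq> 0 \<and> snd r \<notin> (\<Union>j<n. Q n j (snd (x j))) \<and>
    N (\<lambda>t. complex_of_real (C n * indicator (F n) t) - fst r * left_translate (snd r) f t)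
      < ennreal (1 / real (Suc n))" for x :: "nat \<Rightarrow> complex \<times> 'g" and n r
  have "\<exists>x. \<forall>n. P x n (x n)"
  proof (rule dependent_wellorder_choice)
    show "P x n r = P y n r" if "\<And>j. j < n \<Longrightarrow> x j = y j" for r x y n
      using that by (auto simp: P_def)
    fix n and x :: "nat \<Rightarrow> complex \<times> 'g"
    have "compact (\<Union>j<n. Q n j (snd (x j)))"
      using compact_Q by (intro compact_UN) auto
    moreover have "0 < 1 / real (Suc n)" by simp
    ultimately obtain c s where "c \<in> \<Gamma>" "s \<in> S" "c \<noteq> 0" "s \<notin> (\<Union>j<n. Q n j (snd (x j)))"
      "N (\<lambda>t. complex_of_real (C n * indicator (F n) t) - c * left_translate s f t) < ennreal (1 / real (Suc n))"
      using dense_vector_approx_escaping[OF dense nc compact_F[of n] F_pos[of n] _ C_pos[of n]] by meson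
    then have "P x n (c, s)" unfolding P_def by simp
    then show "\<exists>r. P x n r" by blast
  qed
  then obtain x where x: "\<And>n. P x n (x n)" by blast
  define c where "c n = fst (x n)" for n
  define s where "s n = snd (x n)" for n
  have c_mem: "c n \<in> \<Gamma>" and s_mem: "s n \<in> S" and c_nz: "c n \<noteq> 0"
    and err: "N (\<lambda>t. complex_of_real (C n * indicator (F n) t) - c n * left_translate (s n) f t)
      < ennreal (1 / real (Suc n))" for n
    using x[of n] by (auto simp: P_def c_def s_def)
  have "s n \<notin> Q n j (s j)" if "j < n" for j n
    using x[of n] that by (auto simp: P_def s_def)
  then have "\<not> (s n + t \<in> F n \<and> s j + t \<in> F j)" if "j < n" for j n t
  proof -
    have "s n = (s n + t) + - (s j + t) + s j" by (simp add: add.assoc minus_add)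
    then have "s n \<in> Q n j (s j)" if "s n + t \<in> F n" "s j + t \<in> F j"
      unfolding Q_def image_image using that
      by (intro image_eqI[of _ _ "(s n + t, s j + t)"]) auto
    then show ?thesis using \<open>j < n\<close> \<open>\<And>n j. j < n \<Longrightarrow> s n \<notin> Q n j (s j)\<close> by blast
  qed
  then have disj: "j = n" if "s n + t \<in> F n" "s j + t \<in> F j" for j n t
    using that by (metis linorder_neqE_nat)
  obtain c' where c': "\<And>n. c' n \<in> \<Gamma>'" "\<And>n. cmod (c' n) = cmod (c n)"
    using same_mod[OF c_mem] by metis
  have c'_nz: "c' n \<noteq> 0" for n using c'(2)[of n] c_nz[of n] by auto

  define L where "L n = {t \<in> F n. cmod (complex_of_real (C n) - c n * f (- s n + t)) < C n / 2}" for n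
  have L_sub: "L n \<subseteq> F n" for n by (auto simp: L_def)
  have [measurable]: "L n \<in> sets borel" for n
    unfolding L_def by measurable
  \<comment> \<open>By \<open>disj\<close> at most one term is nonzero at each \<open>t\<close>;
    writing \<open>g\<close> as a series gives measurability directly and the value \<open>0\<close>
    off all pieces.\<close>
  define g where "g t = (\<Sum>n. if s n + t \<in> L n then \<psi> n (s n + t) / c' n else 0)" for t
  have [measurable]: "g \<in> borel_measurable borel"
    unfolding g_def by measurable
  then have [measurable]: "g \<in> borel_measurable \<mu>"
    using measurable_cong_sets[OF sets_haar refl] by blast
  have g_eq: "g t = (if s n + t \<in> L n then \<psi> n (s n + t) / c' n else 0)" if "s n + t \<in> F n" for n t
  proof -
    have "g t = (\<Sum>n\<in>{n}. if s n + t \<in> L n then \<psi> n (s n + t) / c' n else 0)"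
      unfolding g_def
    proof (rule suminf_finite)
      fix j assume "j \<notin> {n}"
      then have "s j + t \<notin> L j" using disj[OF that] L_sub by blast
      then show "(if s j + t \<in> L j then \<psi> j (s j + t) / c' j else 0) = 0" by simp
    qed simp
    then show ?thesis by simp
  qed
  have g_bound: "cmod (g t) \<le> 2 * cmod (f t)" for t
  proof (cases "\<exists>n. s n + t \<in> L n")
    case True
    then obtain n where n: "s n + t \<in> L n" by blast
    then have "s n + t \<in> F n" using L_sub by blast
    have "cmod (complex_of_real (C n) - c n * f t) < C n / 2"
      using n by (simp add: L_def flip: add.assoc)
    moreover have "C n - cmod (c n * f t) \<le> cmod (complex_of_real (C n) - c n * f t)"
      using norm_triangle_ineq2[of "complex_of_real (C n)" "c n * f t"] C_pos[of n] by simp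
    ultimately have "C n \<le> 2 * cmod (f t) * cmod (c n)"
      by (simp add: norm_mult mult_ac)
    moreover have "cmod (\<psi> n (s n + t)) \<le> C n"
      using \<psi>_bound[of n "s n + t"] \<open>s n + t \<in> F n\<close> by simp
    ultimately show ?thesis
      using g_eq[OF \<open>s n + t \<in> F n\<close>] n c'(2)[of n] c_nz[of n]
      by (simp add: norm_divide divide_le_eq)
  next
    case False
    then have "g t = 0" by (simp add: g_def)
    then show ?thesis by simp
  qed
  \<comment> \<open>On \<open>L n\<close> the left side is \<open>0\<close>. On the rest of
    \<open>F n\<close> the translate of \<open>g\<close> vanishes, so the left side is at most
    \<open>C n\<close>, while the error of \<open>f\<close> is at least \<open>C n / 2\<close>. Off
    \<open>F n\<close> both targets vanish and \<open>g_bound\<close> applies, since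
    \<open>c n\<close> and \<open>c' n\<close> have equal modulus.\<close>
  have err_bound: "cmod (\<psi> n t - c' n * left_translate (s n) g t)
      \<le> 2 * cmod (complex_of_real (C n * indicator (F n) t) - c n * left_translate (s n) f t)" for n t
  proof -
    have t: "s n + (- s n + t) = t" by (simp flip: add.assoc)
    show ?thesis
    proof (cases "t \<in> F n")
      case True
      then have "g (- s n + t) = (if t \<in> L n then \<psi> n t / c' n else 0)"
        using g_eq[of n "- s n + t"] unfolding t by simp
      moreover have "cmod (\<psi> n t) \<le> C n" using \<psi>_bound[of n t] True by simp
      ultimately show ?thesis
        using True c'_nz[of n] by (auto simp: left_translate_def L_def)
    next
      case False
      then have "\<psi> n t = 0" using \<psi>_bound[of n t] by simp
      moreover have "cmod (c n) * cmod (g (- s n + t)) \<le> cmod (c n) * (2 * cmod (f (- s n + t)))"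
        using g_bound by (intro mult_left_mono) auto
      ultimately show ?thesis
        using False by (simp add: left_translate_def norm_mult c'(2))
    qed
  qed

  have "N g \<le> ennreal (2 powr p) * N f"
    using p_ge_1 weight g_bound by (intro Lp_mod_mono) auto
  also have "\<dots> < \<infinity>" using \<open>N f < \<infinity>\<close> by (simp add: ennreal_mult_less_top)
  finally have g_mem: "g \<in> Lp_space \<mu> p \<omega>" by (simp add: Lp_space_iff_Lp_mod[OF weight])
  \<comment> \<open>With \<open>c 0\<close> a nonzero element of \<open>\<Gamma>\<close>, the
    function \<open>c 0 * left_translate u f t\<close> is a known member of the space, and by
    \<open>g_bound\<close> a constant multiple of it majorizes every multiple of the translate of
    \<open>g\<close>.\<close>
  have orbit: "(\<lambda>t. d * left_translate u g t) \<in> Lp_space \<mu> p \<omega>" if u: "u \<in> S" for d u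
  proof -
    have "(\<lambda>t. c 0 * left_translate u f t) \<in> Lp_space \<mu> p \<omega>"
      using dense c_mem[of 0] u unfolding dense_vector_def dense_in_Lp_def by blast
    then have fin: "N (\<lambda>t. c 0 * left_translate u f t) < \<infinity>"
      by (simp add: Lp_space_iff_Lp_mod[OF weight])
    have "N (\<lambda>t. d * left_translate u g t)
        \<le> ennreal ((2 * cmod d / cmod (c 0)) powr p) * N (\<lambda>t. c 0 * left_translate u f t)"
    proof (rule Lp_mod_mono)
      fix t
      have "cmod (d * left_translate u g t) \<le> cmod d * (2 * cmod (left_translate u f t))"
        unfolding norm_mult left_translate_def using g_bound by (intro mult_left_mono) auto
      then show "cmod (d * left_translate u g t) \<le> 2 * cmod d / cmod (c 0) * cmod (c 0 * left_translate u f t)"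
        using c_nz[of 0] by (simp add: norm_mult mult_ac)
    qed (use p_ge_1 weight in auto)
    also have "\<dots> < \<infinity>" using fin by (simp add: ennreal_mult_less_top)
    finally show ?thesis by (simp add: Lp_space_iff_Lp_mod[OF weight])
  qed
  have approx: "\<exists>d\<in>\<Gamma>'. \<exists>u\<in>S. N (\<lambda>t. h t - d * left_translate u g t) < ennreal \<delta>"
    if h: "h \<in> Lp_space \<mu> p \<omega>" and "0 < \<delta>" for h \<delta>
  proof -
    have [measurable]: "h \<in> borel_measurable \<mu>" and "N h < \<infinity>"
      using h by (auto simp: Lp_space_iff_Lp_mod[OF weight])
    define \<delta>' where "\<delta>' = \<delta> / (2 * 2 powr p)"
    have "0 < \<delta>'" using \<open>0 < \<delta>\<close> by (simp add: \<delta>'_def)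
    obtain m where m: "N (\<lambda>t. h t - \<phi> m t) < ennreal \<delta>'"
      using \<phi>(3)[OF \<open>h \<in> borel_measurable \<mu>\<close> \<open>N h < \<infinity>\<close> \<open>0 < \<delta>'\<close>] by blast
    \<comment> \<open>The index \<open>n\<close> coding \<open>(m, j)\<close> is at least
      \<open>j\<close>, so the error at \<open>n\<close> is below \<open>1 / real (Suc j)\<close>;
      the division by \<open>2 powr p\<close> absorbs the factor 2 of
      \<open>err_bound\<close>.\<close>
    obtain j where j: "1 / real (Suc j) < \<delta>' / 2 powr p"
      using \<open>0 < \<delta>'\<close> nat_approx_posE[of "\<delta>' / 2 powr p"] by auto
    define n where "n = prod_encode (m, j)"
    have "\<psi> n = \<phi> m" by (simp add: \<psi>_def n_def)
    have "j \<le> n" unfolding n_def by (rule le_prod_encode_2)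
    have "N (\<lambda>t. \<psi> n t - c' n * left_translate (s n) g t)
      \<le> ennreal (2 powr p) * N (\<lambda>t. complex_of_real (C n * indicator (F n) t) - c n * left_translate (s n) f t)"
      using p_ge_1 weight err_bound by (intro Lp_mod_mono) auto
    also have "\<dots> < ennreal (2 powr p) * ennreal (1 / real (Suc n))"
      using err by (intro ennreal_mult_strict_left_mono) auto
    also have "\<dots> \<le> ennreal (2 powr p) * ennreal (\<delta>' / 2 powr p)"
    proof (intro mult_left_mono ennreal_leI)
      have "1 / real (Suc n) \<le> 1 / real (Suc j)" using \<open>j \<le> n\<close> by (intro divide_left_mono) auto
      then show "1 / real (Suc n) \<le> \<delta>' / 2 powr p" using j by linarith
    qed simp
    also have "\<dots> = ennreal \<delta>'" by (simp flip: ennreal_mult')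
    finally have "N (\<lambda>t. (h t - \<phi> m t) + (\<psi> n t - c' n * left_translate (s n) g t)) < ennreal \<delta>"
      using m \<phi>(1)[of m] \<open>\<psi> n = \<phi> m\<close> unfolding \<delta>'_def by (intro Lp_mod_less_enlarge) auto
    then have "N (\<lambda>t. h t - c' n * left_translate (s n) g t) < ennreal \<delta>"
      unfolding \<open>\<psi> n = \<phi> m\<close> by simp
    then show ?thesis
      using c'(1) s_mem by blast
  qed
  let ?A = "{(\<lambda>t. d * left_translate u g t) | d u. d \<in> \<Gamma>' \<and> u \<in> S}"
  have "?A \<subseteq> Lp_space \<mu> p \<omega>" using orbit by auto
  moreover have "\<exists>k\<in>?A. N (\<lambda>t. h t - k t) < ennreal \<delta>" if hd: "h \<in> Lp_space \<mu> p \<omega>" "0 < \<delta>" for h \<delta>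
  proof -
    obtain d u where du: "d \<in> \<Gamma>'" "u \<in> S" "N (\<lambda>t. h t - d * left_translate u g t) < ennreal \<delta>"
      using approx[OF hd] by blast
    then have "(\<lambda>t. d * left_translate u g t) \<in> ?A" by blast
    with du(3) show ?thesis by (rule bexI)
  qed
  ultimately have "dense_vector \<mu> p \<omega> \<Gamma>' S g"
    unfolding dense_vector_def dense_in_Lp_iff_Lp_mod[OF weight p_ge_1] using g_mem by simp
  then show ?thesis by blast
qed

end

theorem corollary1p2:
  fixes \<mu> :: "'g::{topological_group_add, t2_space, second_countable_topology} measure"
    and S :: "'g set" and p :: real and \<Gamma> :: "complex set" and \<omega> :: "'g \<Rightarrow> real"
  assumes "locally_compact_space (euclidean :: 'g topology)"
    and "\<not> compact (UNIV :: 'g set)"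
    and "left_haar_measure \<mu>"
    and "1 \<le> p"
    and "\<Gamma> - {0} \<noteq> {}"
    and "weight \<mu> \<omega>"
    and "locally_p_integrable \<mu> p \<omega>"
    and "admissible \<mu> S \<omega>"
  shows "((\<exists>f. dense_vector \<mu> p \<omega> \<Gamma> S f) \<longleftrightarrow>
          (\<exists>f. dense_vector \<mu> p \<omega> ((\<lambda>z. complex_of_real (cmod z)) ` \<Gamma>) S f)) \<and>
         ((\<exists>f. dense_vector \<mu> p \<omega> (complex_of_real ` {0..}) S f) \<longleftrightarrow>
          (\<exists>f. dense_vector \<mu> p \<omega> UNIV S f))"
proof -
  interpret haar_weight \<mu> p \<omega>
    using assms by unfold_locales
  \<comment> \<open>Kept general in \<open>\<Lambda>\<close>: the second equivalence is the case
    \<open>\<Lambda> = UNIV\<close>, whose moduli are the nonnegative reals.\<close>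
  have moduli: "(\<exists>f. dense_vector \<mu> p \<omega> \<Lambda> S f) \<longleftrightarrow>
      (\<exists>f. dense_vector \<mu> p \<omega> ((\<lambda>z. complex_of_real (cmod z)) ` \<Lambda>) S f)" for \<Lambda>
  proof (intro iffI; elim exE)
    fix f assume "dense_vector \<mu> p \<omega> \<Lambda> S f"
    then show "\<exists>f. dense_vector \<mu> p \<omega> ((\<lambda>z. complex_of_real (cmod z)) ` \<Lambda>) S f"
      by (rule dense_vector_transfer[OF assms(1,2)]) auto
  next
    fix f assume "dense_vector \<mu> p \<omega> ((\<lambda>z. complex_of_real (cmod z)) ` \<Lambda>) S f"
    then show "\<exists>f. dense_vector \<mu> p \<omega> \<Lambda> S f"
      by (rule dense_vector_transfer[OF assms(1,2)]) auto
  qed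
  have "(\<lambda>z. complex_of_real (cmod z)) ` UNIV = complex_of_real ` {0..}"
  proof (intro equalityI subsetI)
    fix z assume "z \<in> complex_of_real ` {0..}"
    then obtain r where "0 \<le> r" "z = complex_of_real (cmod (complex_of_real r))" by auto
    then show "z \<in> (\<lambda>z. complex_of_real (cmod z)) ` UNIV" by blast
  qed auto
  with moduli[of UNIV] moduli[of \<Gamma>] show ?thesis by simp
qed

end
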